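(* Over the semiring $\mathbb{R}_{\max}$, the direct image of a rational semimodule by a linear map need not be rational: there exist integers $n,p$, a rational subsemimodule $\mathcal{X}\subset(\mathbb{R}_{\max})^n$ and a linear map $A:(\mathbb{R}_{\max})^n\to(\mathbb{R}_{\max})^p$ such that $A(\mathcal{X})=\{Ax\mid x\in\mathcal{X}\}$ is not a rational subsemimodule of $(\mathbb{R}_{\max})^p$.
   Context: $\mathbb{R}_{\max}$ is the semiring with set $\mathbb{R}\cup\{-\infty\}$, addition $\oplus=\max$, multiplication $\otimes=+$; its zero is $-\infty$ and its unit is $0$. The free semimodule $(\mathbb{R}_{\max})^n$ has entrywise max as addition and action $(\lambda x)_i=\lambda+x_i$. Linear maps $(\mathbb{R}_{\max})^n\to(\mathbb{R}_{\max})^p$ are the maps $x\mapsto Ax$, $(Ax)_i=\max_j(A_{ij}+x_j)$, with $A\in(\mathbb{R}_{\max})^{p\times n}$. For $G\subset(\mathbb{R}_{\max})^n$, $\mathrm{span}\,G$ is the set of finite linear combinations $\bigoplus_{i=1}^k\lambda_iu^i$ with $u^i\in G$, $\lambda_i\in\mathbb{R}_{\max}$. The class of rational subsets of a monoid $(M,\cdot)$ with unit $1_M$ is the least class of subsets of $M$ that contains all finite subsets and is closed under union, product $U\cdot V=\{u\cdot v\mid u\in U,v\in V\}$, and star $U^*=U^0\cup U\cup U^2\cup\cdots$, where $U^0=\{1_M\}$. A subsemimodule $\mathcal{X}\subset(\mathbb{R}_{\max})^n$ is rational if $\mathcal{X}=\mathrm{span}\,G$ for some rational subset $G$ of the monoid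 $((\mathbb{R}\cup\{-\infty\})^n,+)$ with entrywise addition. *)

theory Defs
  imports "HOL-Algebra.Coset" "Jordan_Normal_Form.Matrix"
begin

section \<open>The semiring of max-plus numbers\<close>

text \<open>
  The ring operations of \<open>rmax\<close> are the tropical ones: \<open>+\<close> is the maximum, \<open>*\<close> is the
  usual addition of reals, \<open>0\<close> is minus infinity and \<open>1\<close> is the real number zero. Hence sums,
  matrices and vectors over \<open>rmax\<close> are the max-plus ones.
\<close>

datatype rmax = MInf | Fin real

instantiation rmax :: comm_semiring_1
begin

definition zero_rmax :: rmax where "0 = MInf"

definition one_rmax :: rmax where "1 = Fin 0"

fun plus_rmax :: "rmax \<Rightarrow> rmax \<Rightarrow> rmax" where
  "MInf + y = y"
| "x + MInf = x"
| "Fin a + Fin b = Fin (max a b)"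

fun times_rmax :: "rmax \<Rightarrow> rmax \<Rightarrow> rmax" where
  "Fin a * Fin b = Fin (a + b)"
| "x * y = MInf"

instance
proof
  fix a b c :: rmax
  show "a + b + c = a + (b + c)" by (cases a; cases b; cases c) (auto simp: max_def)
  show "a + b = b + a" by (cases a; cases b) (auto simp: max_def)
  show "0 + a = a" by (simp add: zero_rmax_def)
  show "a * b * c = a * (b * c)" by (cases a; cases b; cases c) (auto simp: max_def)
  show "a * b = b * a" by (cases a; cases b) (auto simp: max_def)
  show "1 * a = a" by (cases a) (auto simp: one_rmax_def)
  show "(a + b) * c = a * c + b * c" by (cases a; cases b; cases c) (auto simp: max_def)
  show "0 * a = 0" by (simp add: zero_rmax_def)
  show "a * 0 = 0" by (cases a) (auto simp: zero_rmax_def)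
  show "(0::rmax) \<noteq> 1" by (simp add: zero_rmax_def one_rmax_def)
qed

end

section \<open>Rational subsets of a monoid\<close>

primrec set_power :: "('a, 'b) monoid_scheme \<Rightarrow> 'a set \<Rightarrow> nat \<Rightarrow> 'a set" where
  "set_power M U 0 = {\<one>\<^bsub>M\<^esub>}"
| "set_power M U (Suc k) = set_power M U k <#>\<^bsub>M\<^esub> U"

definition set_star :: "('a, 'b) monoid_scheme \<Rightarrow> 'a set \<Rightarrow> 'a set" where
  "set_star M U = (\<Union>k. set_power M U k)"

inductive rational_subset :: "('a, 'b) monoid_scheme \<Rightarrow> 'a set \<Rightarrow> bool"
  for M :: "('a, 'b) monoid_scheme" where
  rational_finite: "finite U \<Longrightarrow> U \<subseteq> carrier M \<Longrightarrow> rational_subset M U"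
| rational_union: "rational_subset M U \<Longrightarrow> rational_subset M V \<Longrightarrow> rational_subset M (U \<union> V)"
| rational_prod: "rational_subset M U \<Longrightarrow> rational_subset M V \<Longrightarrow> rational_subset M (U <#>\<^bsub>M\<^esub> V)"
| rational_star: "rational_subset M U \<Longrightarrow> rational_subset M (set_star M U)"

section \<open>Rational semimodules\<close>

text \<open>
  The monoid of vectors of length \<open>n\<close> under entrywise addition of extended reals, which is
  the entrywise product of the semiring \<open>rmax\<close>.
\<close>

definition rmax_vec_monoid :: "nat \<Rightarrow> rmax vec monoid" where
  "rmax_vec_monoid n = \<lparr>carrier = carrier_vec n,
     monoid.mult = (\<lambda>x y. vec n (\<lambda>i. x $ i * y $ i)),
     one = vec n (\<lambda>_. 1)\<rparr>"

lemma monoid_rmax_vec_monoid: "monoid (rmax_vec_monoid n)"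
  by unfold_locales (auto simp: rmax_vec_monoid_def mult.assoc)

text \<open>
  The empty combination (\<open>k = 0\<close>) is allowed, so the span of the empty set is the zero
  semimodule.
\<close>

definition rmax_span :: "nat \<Rightarrow> rmax vec set \<Rightarrow> rmax vec set" where
  "rmax_span n G = {finsum_vec TYPE(rmax) n (\<lambda>i. c i \<cdot>\<^sub>v u i) {..<k} | (k::nat) c u.
     \<forall>i<k. u i \<in> G}"

definition subsemimodule :: "nat \<Rightarrow> rmax vec set \<Rightarrow> bool" where
  "subsemimodule n X \<longleftrightarrow> X \<subseteq> carrier_vec n \<and> 0\<^sub>v n \<in> X \<and>
     (\<forall>x\<in>X. \<forall>y\<in>X. x + y \<in> X) \<and> (\<forall>c. \<forall>x\<in>X. c \<cdot>\<^sub>v x \<in> X)"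

text \<open>
  A span is always a subsemimodule, so this need not be required separately in the definition of
  rationality.
\<close>

lemma subsemimodule_rmax_span:
  assumes G: "G \<subseteq> carrier_vec n"
  shows "subsemimodule n (rmax_span n G)"
proof -
  let ?S = "\<lambda>k c u. finsum_vec TYPE(rmax) n (\<lambda>i. c i \<cdot>\<^sub>v u i) {..<k::nat}"
  have mem: "?S k c u \<in> rmax_span n G" if "\<forall>i<k. u i \<in> G" for k c u
    using that unfolding rmax_span_def by blast
  have car: "(\<lambda>i. c i \<cdot>\<^sub>v u i) \<in> {..<k} \<rightarrow> carrier_vec n"
    if "\<forall>i<k. u i \<in> G" for k :: nat and c and u :: "nat \<Rightarrow> rmax vec"
    using that G by (intro funcsetI smult_carrier_vec[THEN iffD2]) blast
  have clos: "?S k c u \<in> carrier_vec n" if "\<forall>i<k. u i \<in> G" for k c u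
    by (rule finsum_vec_closed[OF car[OF that]])
  have nth: "?S k c u $ j = (\<Sum>i<k. c i * u i $ j)"
    if u: "\<forall>i<k. u i \<in> G" and j: "j < n" for k c u j
  proof -
    have "?S k c u $ j = (\<Sum>i<k. (c i \<cdot>\<^sub>v u i) $ j)"
      by (rule index_finsum_vec[OF finite_lessThan j car[OF u]])
    also have "\<dots> = (\<Sum>i<k. c i * u i $ j)"
    proof (rule sum.cong[OF refl])
      fix i assume "i \<in> {..<k}"
      then have "u i \<in> carrier_vec n" using u G by blast
      then show "(c i \<cdot>\<^sub>v u i) $ j = c i * u i $ j" using j by auto
    qed
    finally show ?thesis .
  qed
  have sub: "rmax_span n G \<subseteq> carrier_vec n"
    using clos unfolding rmax_span_def by blast
  have zero: "0\<^sub>v n \<in> rmax_span n G"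
    using mem[of 0] by (simp add: finsum_vec_empty)
  have add: "x + y \<in> rmax_span n G"
    if xs: "x \<in> rmax_span n G" and ys: "y \<in> rmax_span n G" for x y
  proof -
    obtain k c u where x: "x = ?S k c u" and u: "\<forall>i<k. u i \<in> G"
      using xs unfolding rmax_span_def by blast
    obtain l d v where y: "y = ?S l d v" and v: "\<forall>i<l. v i \<in> G"
      using ys unfolding rmax_span_def by blast
    define e where "e = (\<lambda>i. if i < k then c i else d (i - k))"
    define w where "w = (\<lambda>i. if i < k then u i else v (i - k))"
    have w: "\<forall>i<k + l. w i \<in> G"
      using u v by (auto simp: w_def)
    have dims: "x \<in> carrier_vec n" "y \<in> carrier_vec n" "?S (k + l) e w \<in> carrier_vec n"
      unfolding x y by (rule clos, fact)+
    have "?S (k + l) e w = x + y"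
    proof (rule eq_vecI)
      show "dim_vec (?S (k + l) e w) = dim_vec (x + y)"
        using dims by simp
    next
      fix j assume "j < dim_vec (x + y)"
      then have j: "j < n" using dims by simp
      have split: "(\<Sum>i<k + l. f i) = (\<Sum>i<k. f i) + (\<Sum>i<l. f (k + i))" for f :: "nat \<Rightarrow> rmax"
        by (induction l) (simp_all add: add.assoc)
      have "?S (k + l) e w $ j = (\<Sum>i<k + l. e i * w i $ j)"
        by (rule nth[OF w j])
      also have "\<dots> = (\<Sum>i<k. c i * u i $ j) + (\<Sum>i<l. d i * v i $ j)"
        unfolding split by (simp add: e_def w_def)
      also have "\<dots> = x $ j + y $ j"
        unfolding x y nth[OF u j] nth[OF v j] ..
      also have "\<dots> = (x + y) $ j"
        using dims j by simp
      finally show "?S (k + l) e w $ j = (x + y) $ j" .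
    qed
    then show ?thesis using mem[OF w, of e] by simp
  qed
  have smult: "a \<cdot>\<^sub>v x \<in> rmax_span n G" if xs: "x \<in> rmax_span n G" for a x
  proof -
    obtain k c u where x: "x = ?S k c u" and u: "\<forall>i<k. u i \<in> G"
      using xs unfolding rmax_span_def by blast
    have dims: "x \<in> carrier_vec n" "?S k (\<lambda>i. a * c i) u \<in> carrier_vec n"
      unfolding x by (rule clos, fact)+
    have "?S k (\<lambda>i. a * c i) u = a \<cdot>\<^sub>v x"
    proof (rule eq_vecI)
      show "dim_vec (?S k (\<lambda>i. a * c i) u) = dim_vec (a \<cdot>\<^sub>v x)"
        using dims by simp
    next
      fix j assume "j < dim_vec (a \<cdot>\<^sub>v x)"
      then have j: "j < n" using dims by simp
      have "?S k (\<lambda>i. a * c i) u $ j = a * x $ j"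
        unfolding x nth[OF u j] by (simp add: sum_distrib_left mult.assoc)
      then show "?S k (\<lambda>i. a * c i) u $ j = (a \<cdot>\<^sub>v x) $ j"
        using dims j by simp
    qed
    then show ?thesis using mem[OF u, of "\<lambda>i. a * c i"] by simp
  qed
  show ?thesis
    using sub zero add smult unfolding subsemimodule_def by blast
qed

definition rational_semimodule :: "nat \<Rightarrow> rmax vec set \<Rightarrow> bool" where
  "rational_semimodule n X \<longleftrightarrow>
     (\<exists>G. rational_subset (rmax_vec_monoid n) G \<and> X = rmax_span n G)"

end

theory Submission
  imports Defs
begin

text \<open>
  Up to scaling, a vector of the plane with finite entries is its slope, the difference of the two
  entries. The slope is additive, so the slopes of a rational set of the plane form a rational
  subset of the real line; such a set attains its infimum if that is finite, because a star either
  has a negative period and is unbounded below, or has minimum 0.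

  On the other hand, take the vectors \<open>(t, -t, 0)\<close> for \<open>t = a - b \<surd>2\<close> with integers
  \<open>a \<ge> 1\<close> and \<open>b \<ge> 0\<close>. They form a rational set, and the linear map
  \<open>(x\<^sub>0, x\<^sub>1, x\<^sub>2) \<mapsto> (max x\<^sub>0 x\<^sub>1, x\<^sub>2)\<close> sends them to vectors of slope \<open>\<bar>t\<bar>\<close>. These
  slopes are positive with infimum 0, and the same then holds for any generating set of the image.
\<close>

section \<open>Max-plus sums, rational sets and spans\<close>

lemma rmax_sum_eq_FinD:
  assumes "finite I" "sum f I = Fin y"
  shows "\<exists>i\<in>I. f i = Fin y"
  using assms
proof (induction I arbitrary: y rule: finite_induct)
  case empty
  then show ?case by (simp add: zero_rmax_def)
next
  case (insert i I)
  then show ?case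
    by (cases "f i"; cases "sum f I") (auto simp: max_def split: if_splits)
qed

lemma rmax_sum_ge:
  assumes "finite I" "i \<in> I" "f i = Fin a"
  obtains b where "sum f I = Fin b" "a \<le> b"
proof -
  have "sum f I = f i + sum f (I - {i})"
    using assms(1,2) by (rule sum.remove)
  then show thesis
    using assms(3) that by (cases "sum f (I - {i})") auto
qed

lemma rational_subset_carrier:
  assumes "monoid M" "rational_subset M U"
  shows "U \<subseteq> carrier M"
  using assms(2)
proof induction
  case (rational_prod U V)
  then show ?case
    using monoid.m_closed[OF assms(1)] by (auto simp: set_mult_def)
next
  case (rational_star U)
  have "set_power M U k \<subseteq> carrier M" for k
    using rational_star monoid.m_closed[OF assms(1)] monoid.one_closed[OF assms(1)]
    by (induction k) (fastforce simp: set_mult_def)+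
  then show ?case by (auto simp: set_star_def)
qed auto

lemma rmax_span_elemE:
  assumes "G \<subseteq> carrier_vec n" "x \<in> rmax_span n G"
  obtains k :: nat and u c where "\<forall>i<k. u i \<in> G"
    "\<forall>j<n. x $ j = (\<Sum>i<k. c i * u i $ j)"
proof -
  obtain k :: nat and c u where x: "x = finsum_vec TYPE(rmax) n (\<lambda>i. c i \<cdot>\<^sub>v u i) {..<k}"
    and u: "\<forall>i<k. u i \<in> G"
    using assms(2) unfolding rmax_span_def by blast
  have car: "u i \<in> carrier_vec n" if "i < k" for i
    using u assms(1) that by blast
  have "x $ j = (\<Sum>i<k. c i * u i $ j)" if j: "j < n" for j
  proof -
    have "x $ j = (\<Sum>i<k. (c i \<cdot>\<^sub>v u i) $ j)"
      unfolding x using car by (intro index_finsum_vec j) auto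
    also have "\<dots> = (\<Sum>i<k. c i * u i $ j)"
    proof (intro sum.cong refl)
      fix i assume "i \<in> {..<k}"
      then have "dim_vec (u i) = n" using car by (simp add: carrier_vecD)
      then show "(c i \<cdot>\<^sub>v u i) $ j = c i * u i $ j" using j by simp
    qed
    finally show ?thesis .
  qed
  then show thesis using u that by blast
qed

lemma rmax_span_superset:
  assumes "G \<subseteq> carrier_vec n"
  shows "G \<subseteq> rmax_span n G"
proof
  fix x assume x: "x \<in> G"
  then have car: "x \<in> carrier_vec n" using assms by blast
  let ?S = "finsum_vec TYPE(rmax) n (\<lambda>i. 1 \<cdot>\<^sub>v x) {..<1::nat}"
  have "(\<lambda>i::nat. 1 \<cdot>\<^sub>v x) \<in> {..<1} \<rightarrow> carrier_vec n"
    using car by auto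
  note S = finsum_vec_closed[OF this] index_finsum_vec[OF _ _ this]
  have "?S = x"
    by (rule eq_vecI) (use S car in auto)
  moreover have "?S \<in> rmax_span n G"
    unfolding rmax_span_def using x
    by (intro CollectI exI[of _ 1] exI[of _ "\<lambda>_. 1"] exI[of _ "\<lambda>_. x"]) auto
  ultimately show "x \<in> rmax_span n G" by simp
qed

section \<open>Slopes of rational subsets of the plane\<close>

definition slopes :: "rmax vec set \<Rightarrow> real set" where
  "slopes U = {a - b | a b. \<exists>u\<in>U. u $ 0 = Fin a \<and> u $ 1 = Fin b}"

lemma rmax_times_eq_Fin:
  "x * y = Fin c \<longleftrightarrow> (\<exists>a b. x = Fin a \<and> y = Fin b \<and> c = a + b)"
  by (cases x; cases y) auto

lemma slopes_Un: "slopes (U \<union> V) = slopes U \<union> slopes V"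
  by (auto simp: slopes_def)

text \<open>An entry of a product is finite only if both factors have it finite, so a vector without
  slope never contributes to a slope of the product. This gives equality, not just one
  inclusion.\<close>

lemma slopes_set_mult:
  "slopes (U <#>\<^bsub>rmax_vec_monoid 2\<^esub> V) = {s + t | s t. s \<in> slopes U \<and> t \<in> slopes V}"
proof (intro equalityI subsetI)
  fix r assume "r \<in> slopes (U <#>\<^bsub>rmax_vec_monoid 2\<^esub> V)"
  then obtain u v a b a' b' where "u \<in> U" "v \<in> V" and fin: "u $ 0 = Fin a" "v $ 0 = Fin a'"
      "u $ 1 = Fin b" "v $ 1 = Fin b'" and r: "r = (a + a') - (b + b')"
    by (auto simp: slopes_def set_mult_def rmax_vec_monoid_def rmax_times_eq_Fin)
  then have "a - b \<in> slopes U" "a' - b' \<in> slopes V" "r = (a - b) + (a' - b')"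
    by (auto simp: slopes_def)
  then show "r \<in> {s + t | s t. s \<in> slopes U \<and> t \<in> slopes V}" by blast
next
  fix r assume "r \<in> {s + t | s t. s \<in> slopes U \<and> t \<in> slopes V}"
  then obtain u v a b a' b' where uv: "u \<in> U" "v \<in> V" and fin: "u $ 0 = Fin a" "v $ 0 = Fin a'"
      "u $ 1 = Fin b" "v $ 1 = Fin b'" and r: "r = (a - b) + (a' - b')"
    unfolding slopes_def by blast
  let ?w = "u \<otimes>\<^bsub>rmax_vec_monoid 2\<^esub> v"
  have "?w \<in> U <#>\<^bsub>rmax_vec_monoid 2\<^esub> V"
    using uv by (auto simp: set_mult_def)
  moreover have "?w $ 0 = Fin (a + a')" "?w $ 1 = Fin (b + b')"
    using fin by (simp_all add: rmax_vec_monoid_def)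
  moreover have "r = (a + a') - (b + b')" using r by simp
  ultimately show "r \<in> slopes (U <#>\<^bsub>rmax_vec_monoid 2\<^esub> V)"
    unfolding slopes_def by blast
qed

text \<open>Induction on the construction of the set. The induction hypotheses are conditional, so
  each case first passes nonemptiness and boundedness on to the operands.\<close>

lemma rational_slopes_attain_min:
  assumes "rational_subset (rmax_vec_monoid 2) U" "slopes U \<noteq> {}" "bdd_below (slopes U)"
  shows "\<exists>m\<in>slopes U. \<forall>s\<in>slopes U. m \<le> s"
  using assms
proof (induction rule: rational_subset.induct)
  case (rational_finite U)
  \<comment> \<open>For a vector with an infinite entry \<open>THE\<close> gives an unspecified
    value. This is harmless, since only an inclusion in a finite image is needed.\<close>
  have "slopes U \<subseteq> (\<lambda>u. (THE a. u $ 0 = Fin a) - (THE b. u $ 1 = Fin b)) ` U"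
    by (force simp: slopes_def)
  then have "finite (slopes U)"
    using rational_finite(1) by (rule finite_surj[rotated])
  then show ?case
    using rational_finite Min_in Min_le by blast
next
  case (rational_union U V)
  then have bdd: "bdd_below (slopes U)" "bdd_below (slopes V)"
    by (simp_all add: slopes_Un)
  show ?case
  proof (cases "slopes U = {} \<or> slopes V = {}")
    case True
    then have "slopes (U \<union> V) = slopes U \<or> slopes (U \<union> V) = slopes V"
      by (auto simp: slopes_Un)
    then show ?thesis using rational_union by metis
  next
    case False
    then obtain m n where "m \<in> slopes U" "\<forall>s\<in>slopes U. m \<le> s"
      "n \<in> slopes V" "\<forall>s\<in>slopes V. n \<le> s"
      using rational_union bdd by blast
    then show ?thesis
      by (intro bexI[of _ "min m n"]) (auto simp: slopes_Un min_def)
  qed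
next
  case (rational_prod U V)
  obtain l where l: "\<And>s t. s \<in> slopes U \<Longrightarrow> t \<in> slopes V \<Longrightarrow> l \<le> s + t"
    using rational_prod.prems(2) unfolding slopes_set_mult bdd_below_def by blast
  obtain s0 t0 where 0: "s0 \<in> slopes U" "t0 \<in> slopes V"
    using rational_prod.prems(1) unfolding slopes_set_mult by blast
  \<comment> \<open>With one slope of the other factor held fixed, a lower bound for the sums bounds
    each factor separately.\<close>
  have "l - t0 \<le> s" if "s \<in> slopes U" for s
    using l[OF that 0(2)] by linarith
  then have "bdd_below (slopes U)" by (rule bdd_belowI)
  moreover have "l - s0 \<le> t" if "t \<in> slopes V" for t
    using l[OF 0(1) that] by linarith
  then have "bdd_below (slopes V)" by (rule bdd_belowI)
  ultimately obtain m n where mn: "m \<in> slopes U" "\<forall>s\<in>slopes U. m \<le> s"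
      "n \<in> slopes V" "\<forall>s\<in>slopes V. n \<le> s"
    using rational_prod.IH 0 by blast
  then show ?case
    unfolding slopes_set_mult by (intro bexI[of _ "m + n"]) (auto intro: add_mono)
next
  case (rational_star U)
  let ?M = "rmax_vec_monoid 2"
  have star: "slopes (set_star ?M U) = (\<Union>k. slopes (set_power ?M U k))"
    by (auto simp: slopes_def set_star_def)
  have unit: "slopes (set_power ?M U 0) = {0}"
    by (auto simp: slopes_def rmax_vec_monoid_def one_rmax_def)
  have mult: "real k * s \<in> slopes (set_power ?M U k)" if "s \<in> slopes U" for k s
  proof (induction k)
    case 0
    then show ?case using unit by simp
  next
    case (Suc k)
    have "real (Suc k) * s = real k * s + s" by (simp add: algebra_simps)
    then show ?case using Suc that unfolding set_power.simps slopes_set_mult by blast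
  qed
  obtain l where l: "\<And>s. s \<in> slopes (set_star ?M U) \<Longrightarrow> l \<le> s"
    using rational_star.prems(2) unfolding bdd_below_def by blast
  \<comment> \<open>By the Archimedean property, the multiples of a negative slope would fall below
    \<open>l\<close>.\<close>
  have nonneg: "0 \<le> s" if "s \<in> slopes U" for s
  proof (rule ccontr)
    assume "\<not> 0 \<le> s"
    then have "\<forall>r. \<exists>k. r < real k * (- s)"
      by (intro reals_Archimedean3) simp
    then obtain k where "- l < real k * (- s)" by blast
    moreover have "l \<le> real k * s" using mult[OF that] l star by blast
    ultimately show False by simp
  qed
  have "0 \<le> s" if "s \<in> slopes (set_power ?M U k)" for s k
    using that
  proof (induction k arbitrary: s)
    case 0
    then show ?case using unit by simp
  next
    case (Suc k)
    then show ?case using nonneg by (force simp: slopes_set_mult)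
  qed
  \<comment> \<open>The power with exponent 0 contributes the slope 0, which is therefore the
    minimum.\<close>
  then show ?case
    unfolding star using unit by (intro bexI[of _ 0] UN_I[of 0]) auto
qed

section \<open>Small positive numbers of the form a - b sqrt 2\<close>

lemma nat_neq_sqrt2_mult:
  assumes "0 < a"
  shows "real a \<noteq> real b * sqrt 2"
  using assms
proof (induction a arbitrary: b rule: less_induct)
  case (less a)
  show ?case
  proof
    assume eq: "real a = real b * sqrt 2"
    then have "real (a * a) = real (2 * (b * b))" by simp
    then have sq: "a * a = 2 * (b * b)" using of_nat_eq_iff by blast
    then have "even a" by (metis dvd_triv_left even_mult_iff)
    then obtain c where c: "a = 2 * c" by blast
    then have "b * b = 2 * (c * c)" using sq by simp
    then have "even b" by (metis dvd_triv_left even_mult_iff)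
    then obtain d where "b = 2 * d" by blast
    \<comment> \<open>Infinite descent: halving both numbers gives a smaller solution of the same
      equation.\<close>
    then have "real c = real d * sqrt 2" using eq c by simp
    moreover have "0 < c" "c < a" using c less.prems by auto
    ultimately show False using less.IH by blast
  qed
qed

text \<open>The base is the square of sqrt 2 - 1. The signs of the two coefficients alternate along
  the powers of sqrt 2 - 1; taking even powers only keeps the pattern required here.\<close>

lemma power_3_minus_2sqrt2:
  "\<exists>a b. (3 - 2 * sqrt 2) ^ k = real (Suc a) - real b * sqrt 2"
proof (induction k)
  case 0
  show ?case by (intro exI[of _ 0]) simp
next
  case (Suc k)
  then obtain a b where ab: "(3 - 2 * sqrt 2) ^ k = real (Suc a) - real b * sqrt 2" by blast
  have "(3 - 2 * sqrt 2) ^ Suc k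
      = real (Suc (2 + 3 * a + 4 * b)) - real (2 * Suc a + 3 * b) * sqrt 2"
    unfolding power_Suc ab by (simp add: algebra_simps)
  then show ?case by blast
qed

lemma small_nat_minus_nat_sqrt2:
  assumes "0 < e"
  obtains a b where "0 < real (Suc a) - real b * sqrt 2" "real (Suc a) - real b * sqrt 2 < e"
proof -
  have "sqrt 2 < 3 / 2"
    by (rule real_less_lsqrt) (simp_all add: power2_eq_square)
  moreover have "1 < sqrt 2" by simp
  ultimately have r: "0 < 3 - 2 * sqrt 2" "3 - 2 * sqrt 2 < 1" by auto
  obtain k where "(3 - 2 * sqrt 2) ^ k < e"
    using real_arch_pow_inv[OF assms r(2)] by blast
  moreover have "0 < (3 - 2 * sqrt 2) ^ k" using r(1) by simp
  ultimately show thesis using power_3_minus_2sqrt2[of k] that by metis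
qed

section \<open>The rational set in dimension three and its folding\<close>

definition mirror_vec :: "real \<Rightarrow> rmax vec" where
  "mirror_vec t = vec 3 (\<lambda>i. if i = 0 then Fin t else if i = 1 then Fin (- t) else Fin 0)"

lemma mirror_vec_carrier: "mirror_vec t \<in> carrier_vec 3"
  by (simp add: mirror_vec_def)

text \<open>So \<open>mirror_vec\<close> turns addition of reals into the monoid product, and
  products and stars of such vectors can be computed on the parameter.\<close>

lemma mirror_vec_mult:
  "mirror_vec s \<otimes>\<^bsub>rmax_vec_monoid 3\<^esub> mirror_vec t = mirror_vec (s + t)"
  by (auto simp: mirror_vec_def rmax_vec_monoid_def)

lemma mirror_vec_star:
  "set_star (rmax_vec_monoid 3) {mirror_vec t} = range (\<lambda>k. mirror_vec (real k * t))"
proof -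
  have "set_power (rmax_vec_monoid 3) {mirror_vec t} k = {mirror_vec (real k * t)}" for k
  proof (induction k)
    case 0
    show ?case by (auto simp: mirror_vec_def rmax_vec_monoid_def one_rmax_def)
  next
    case (Suc k)
    then show ?case by (simp add: set_mult_def mirror_vec_mult algebra_simps)
  qed
  then show ?thesis by (auto simp: set_star_def)
qed

lemma rational_mirror_set:
  "rational_subset (rmax_vec_monoid 3)
     {mirror_vec (real (Suc a) - real b * sqrt 2) | a b. True}"
proof -
  let ?M = "rmax_vec_monoid 3"
  have single: "rational_subset ?M {mirror_vec t}" for t
    by (rule rational_finite) (simp_all add: rmax_vec_monoid_def mirror_vec_carrier)
  \<comment> \<open>The extra factor \<open>mirror_vec 1\<close> makes the integer coefficient at
    least 1. This excludes the parameter 0, whose image would have slope 0.\<close>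
  let ?G = "{mirror_vec 1} <#>\<^bsub>?M\<^esub>
    (set_star ?M {mirror_vec 1} <#>\<^bsub>?M\<^esub> set_star ?M {mirror_vec (- sqrt 2)})"
  have "rational_subset ?M ?G"
    by (intro rational_prod rational_star single)
  moreover have "?G = (\<Union>a b. {mirror_vec (1 + (real a * 1 + real b * - sqrt 2))})"
    unfolding mirror_vec_star set_mult_def
    by (auto simp: mirror_vec_mult)
  moreover have "1 + (real a * 1 + real b * - sqrt 2) = real (Suc a) - real b * sqrt 2" for a b
    by simp
  ultimately have "rational_subset ?M (\<Union>a b. {mirror_vec (real (Suc a) - real b * sqrt 2)})"
    by (simp only:)
  also have "\<dots> = {mirror_vec (real (Suc a) - real b * sqrt 2) | a b. True}"
    by blast
  finally show ?thesis .
qed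

text \<open>Here \<open>1\<close> is the real number zero and \<open>0\<close> is minus infinity, so
  each row takes the maximum of the entries it selects.\<close>

definition fold_mat :: "rmax mat" where
  "fold_mat = mat 2 3 (\<lambda>(i, j). if i = 0 \<and> j < 2 \<or> i = 1 \<and> j = 2 then 1 else 0)"

lemma fold_mat_mult:
  assumes "x \<in> carrier_vec 3"
  shows "(fold_mat *\<^sub>v x) $ 0 = x $ 0 + x $ 1" "(fold_mat *\<^sub>v x) $ 1 = x $ 2"
  using assms by (auto simp: fold_mat_def scalar_prod_def numeral_3_eq_3 numeral_2_eq_2)

theorem mainTheorem7:
  shows "\<exists>(n::nat) (p::nat) (X :: rmax vec set) (A :: rmax mat).
    rational_semimodule n X \<and> A \<in> carrier_mat p n \<and>
    \<not> rational_semimodule p ((\<lambda>x. A *\<^sub>v x) ` X)"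
proof -
  define G where "G = {mirror_vec (real (Suc a) - real b * sqrt 2) | a b. True}"
  let ?X = "rmax_span 3 G" and ?A = "(\<lambda>x. fold_mat *\<^sub>v x)"
  have G: "G \<subseteq> carrier_vec 3"
    using mirror_vec_carrier by (auto simp: G_def)
  have X: "?X \<subseteq> carrier_vec 3"
    using subsemimodule_rmax_span[OF G] by (simp add: subsemimodule_def)
  \<comment> \<open>Every vector of the image, not only a generator, has first entry strictly above
    a finite second entry \<open>y\<close>: the term that attains \<open>y\<close> already
    contributes y + |t| to the first entry, with t nonzero by irrationality.\<close>
  have above: "\<exists>x>y. v $ 0 = Fin x" if vX: "v \<in> ?A ` ?X" and v1: "v $ 1 = Fin y" for v y
  proof -
    obtain x where x: "x \<in> ?X" and v: "v = fold_mat *\<^sub>v x" using vX by blast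
    note vx = fold_mat_mult[OF subsetD[OF X x], folded v]
    obtain k :: nat and u c where u: "\<forall>i<k. u i \<in> G"
      and xj: "\<forall>j<3. x $ j = (\<Sum>i<k. c i * u i $ j)"
      by (rule rmax_span_elemE[OF G x])
    have "(\<Sum>i<k. c i * u i $ 2) = Fin y" using v1 vx(2) xj[rule_format, of 2] by simp
    then obtain i where i: "i < k" "c i * u i $ 2 = Fin y"
      using rmax_sum_eq_FinD[of "{..<k}"] by auto
    obtain a b where ui: "u i = mirror_vec (real (Suc a) - real b * sqrt 2)"
      using u i(1) unfolding G_def by blast
    define t where "t = real (Suc a) - real b * sqrt 2"
    have "t \<noteq> 0" using nat_neq_sqrt2_mult[of "Suc a" b] by (simp add: t_def)
    have "c i = Fin y" using i(2) ui by (cases "c i") (auto simp: mirror_vec_def)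
    then have ci: "c i * u i $ 0 = Fin (y + t)" "c i * u i $ 1 = Fin (y - t)"
      using ui by (simp_all add: mirror_vec_def t_def)
    have ik: "i \<in> {..<k}" using i(1) by simp
    obtain p where p: "(\<Sum>i<k. c i * u i $ 0) = Fin p" "y + t \<le> p"
      by (rule rmax_sum_ge[where f = "\<lambda>i. c i * u i $ 0", OF finite_lessThan ik ci(1)])
    obtain q where q: "(\<Sum>i<k. c i * u i $ 1) = Fin q" "y - t \<le> q"
      by (rule rmax_sum_ge[where f = "\<lambda>i. c i * u i $ 1", OF finite_lessThan ik ci(2)])
    have "v $ 0 = Fin (max p q)"
      using p(1) q(1) xj[rule_format, of 0] xj[rule_format, of 1] vx(1) by simp
    moreover have "y < max p q" using p(2) q(2) \<open>t \<noteq> 0\<close> by auto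
    ultimately show ?thesis by blast
  qed
  \<comment> \<open>For a generator with 0 < t < e the maximum of t and -t is t, and the third entry
    is 0.\<close>
  have small: "\<exists>v\<in>?A ` ?X. \<exists>d<e. v $ 0 = Fin d \<and> v $ 1 = Fin 0" if e: "0 < e" for e
  proof -
    obtain a b where t: "0 < real (Suc a) - real b * sqrt 2" "real (Suc a) - real b * sqrt 2 < e"
      using small_nat_minus_nat_sqrt2[OF e] .
    define t where "t = real (Suc a) - real b * sqrt 2"
    have "mirror_vec t \<in> ?X"
      using rmax_span_superset[OF G] unfolding G_def t_def by blast
    moreover have "(fold_mat *\<^sub>v mirror_vec t) $ 0 = Fin t" "(fold_mat *\<^sub>v mirror_vec t) $ 1 = Fin 0"
      using t unfolding fold_mat_mult[OF mirror_vec_carrier] t_def[symmetric]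
      by (simp_all add: mirror_vec_def)
    ultimately show ?thesis using t(2) unfolding t_def by blast
  qed
  have "\<not> rational_semimodule 2 (?A ` ?X)"
  proof
    assume "rational_semimodule 2 (?A ` ?X)"
    then obtain H where H: "rational_subset (rmax_vec_monoid 2) H" and AX: "?A ` ?X = rmax_span 2 H"
      unfolding rational_semimodule_def by blast
    have Hc: "H \<subseteq> carrier_vec 2"
      using rational_subset_carrier[OF monoid_rmax_vec_monoid H] by (simp add: rmax_vec_monoid_def)
    have HX: "H \<subseteq> ?A ` ?X" using rmax_span_superset[OF Hc] AX by simp
    have pos: "0 < s" if "s \<in> slopes H" for s
      using that above HX unfolding slopes_def by fastforce
    \<comment> \<open>An arbitrary generating set \<open>H\<close> inherits the small slopes: in a
      combination with entries \<open>d\<close> and 0, the generator that attains the 0 has slope at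
      most \<open>d\<close>.\<close>
    have arb: "\<exists>s\<in>slopes H. s < e" if e: "0 < e" for e
    proof -
      obtain v d where v: "v \<in> rmax_span 2 H" "d < e" "v $ 0 = Fin d" "v $ 1 = Fin 0"
        using small[OF e] unfolding AX by blast
      obtain k :: nat and u c where u: "\<forall>i<k. u i \<in> H"
        and vj: "\<forall>j<2. v $ j = (\<Sum>i<k. c i * u i $ j)"
        by (rule rmax_span_elemE[OF Hc v(1)])
      obtain i where i: "i < k" "c i * u i $ 1 = Fin 0"
        using rmax_sum_eq_FinD[of "{..<k}" "\<lambda>i. c i * u i $ 1" 0] vj[rule_format, of 1] v(4) by auto
      then obtain l b where l: "c i = Fin l" "u i $ 1 = Fin b" "l + b = 0"
        by (auto simp: rmax_times_eq_Fin)
      have "u i \<in> ?A ` ?X" using u i(1) HX by (simp add: subset_iff)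
      \<comment> \<open>Since \<open>H\<close> lies in the image, \<open>above\<close> also excludes
        an infinite first entry.\<close>
      then obtain a where a: "u i $ 0 = Fin a"
        using above[OF _ l(2)] by metis
      have ci: "c i * u i $ 0 = Fin (l + a)" using l a by simp
      have ik: "i \<in> {..<k}" using i(1) by simp
      obtain d' where "(\<Sum>i<k. c i * u i $ 0) = Fin d'" "l + a \<le> d'"
        by (rule rmax_sum_ge[where f = "\<lambda>i. c i * u i $ 0", OF finite_lessThan ik ci])
      then have "l + a \<le> d" using vj[rule_format, of 0] v(3) by simp
      moreover have "a - b \<in> slopes H"
        using a l(2) u i(1) unfolding slopes_def by blast
      ultimately show ?thesis using l(3) v(2) by (intro bexI[of _ "a - b"]) auto
    qed
    have "slopes H \<noteq> {}" using arb[of 1] by auto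
    moreover have "bdd_below (slopes H)" using pos by (intro bdd_belowI[of _ 0]) (simp add: less_imp_le)
    ultimately obtain m where "m \<in> slopes H" "\<forall>s\<in>slopes H. m \<le> s"
      using rational_slopes_attain_min[OF H] by blast
    \<comment> \<open>The minimum \<open>m\<close> is positive, so \<open>arb\<close> with the bound
      \<open>m\<close> produces a smaller slope.\<close>
    then show False using pos arb[of m] by force
  qed
  moreover have "rational_semimodule 3 ?X"
    using rational_mirror_set unfolding rational_semimodule_def G_def by blast
  moreover have "fold_mat \<in> carrier_mat 2 3" by (simp add: fold_mat_def)
  ultimately show ?thesis by blast
qed

end
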